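(* Let $(G,\cdot,\circ,\Phi)$ be a skew truss. Then the following statements are equivalent: (1) Defining $\rhd:G\times G\to G$ by $a\rhd b=\Phi(a)^{-1}\cdot(a\circ b)$ for all $a,b\in G$, the quadruple $(G,\cdot,\rhd,\Phi)$ is a twisted post-group. (2) The semigroup $(G,\circ)$ is right divisible, that is, for any $a,b\in G$ there is a unique $t\in G$ such that $a\circ t=b$.
   Context: A skew (left) truss is a quadruple $(G,\cdot,\circ,\Phi)$ where $(G,\cdot)$ is a group, $(G,\circ)$ is a semigroup, and $\Phi:G\to G$ is a map such that $a\circ(b\cdot c)=(a\circ b)\cdot\Phi(a)^{-1}\cdot(a\circ c)$ for all $a,b,c\in G$. Inverses are taken in $(G,\cdot)$. A (left) twisted post-group $(G,\cdot,\rhd,\Phi)$ is a group $(G,\cdot)$ with maps $\rhd:G\times G\to G$ and $\Phi:G\to G$ such that, setting $a\circ b=\Phi(a)\cdot(a\rhd b)$, for all $a,b,c\in G$: (i) $b\mapsto a\rhd b$ is a group automorphism of $(G,\cdot)$; (ii) $(a\circ b)\rhd c=a\rhd(b\rhd c)$; (iii) $\Phi(a\circ b)=a\circ\Phi(b)$. *)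

theory Defs
  imports "HOL-Algebra.Group"
begin

text \<open>The group is a HOL-Algebra structure; the further operations are functions on the ambient
  type whose behaviour is constrained only on the carrier.\<close>

definition semigroup_on :: "'a set \<Rightarrow> ('a \<Rightarrow> 'a \<Rightarrow> 'a) \<Rightarrow> bool" where
  "semigroup_on S f \<longleftrightarrow>
     (\<forall>a\<in>S. \<forall>b\<in>S. f a b \<in> S) \<and>
     (\<forall>a\<in>S. \<forall>b\<in>S. \<forall>c\<in>S. f (f a b) c = f a (f b c))"

definition right_divisible_on :: "'a set \<Rightarrow> ('a \<Rightarrow> 'a \<Rightarrow> 'a) \<Rightarrow> bool" where
  "right_divisible_on S f \<longleftrightarrow> (\<forall>a\<in>S. \<forall>b\<in>S. \<exists>!t. t \<in> S \<and> f a t = b)"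

locale skew_truss = group G for G (structure) +
  fixes circ :: "'a \<Rightarrow> 'a \<Rightarrow> 'a" (infixl \<open>\<circ>\<^sub>t\<close> 70)
    and \<Phi> :: "'a \<Rightarrow> 'a"
  assumes semigroup_circ: "semigroup_on (carrier G) (\<circ>\<^sub>t)"
    and Phi_closed: "\<Phi> \<in> carrier G \<rightarrow> carrier G"
    and circ_mult: "\<lbrakk>a \<in> carrier G; b \<in> carrier G; c \<in> carrier G\<rbrakk> \<Longrightarrow>
      a \<circ>\<^sub>t (b \<otimes> c) = (a \<circ>\<^sub>t b) \<otimes> inv (\<Phi> a) \<otimes> (a \<circ>\<^sub>t c)"

definition twisted_circ ::
    "('a, 'm) monoid_scheme \<Rightarrow> ('a \<Rightarrow> 'a \<Rightarrow> 'a) \<Rightarrow> ('a \<Rightarrow> 'a) \<Rightarrow> 'a \<Rightarrow> 'a \<Rightarrow> 'a" where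
  "twisted_circ G tri \<Phi> a b = \<Phi> a \<otimes>\<^bsub>G\<^esub> tri a b"

locale twisted_post_group = group G for G (structure) +
  fixes tri :: "'a \<Rightarrow> 'a \<Rightarrow> 'a" (infixr \<open>\<rhd>\<close> 70)
    and \<Phi> :: "'a \<Rightarrow> 'a"
  assumes tri_closed: "\<lbrakk>a \<in> carrier G; b \<in> carrier G\<rbrakk> \<Longrightarrow> a \<rhd> b \<in> carrier G"
    and Phi_closed: "\<Phi> \<in> carrier G \<rightarrow> carrier G"
    and tri_automorphism: "a \<in> carrier G \<Longrightarrow> (\<lambda>b. a \<rhd> b) \<in> iso G G"
    and tri_twisted_circ: "\<lbrakk>a \<in> carrier G; b \<in> carrier G; c \<in> carrier G\<rbrakk> \<Longrightarrow>
      twisted_circ G (\<rhd>) \<Phi> a b \<rhd> c = a \<rhd> (b \<rhd> c)"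
    and Phi_twisted_circ: "\<lbrakk>a \<in> carrier G; b \<in> carrier G\<rbrakk> \<Longrightarrow>
      \<Phi> (twisted_circ G (\<rhd>) \<Phi> a b) = twisted_circ G (\<rhd>) \<Phi> a (\<Phi> b)"

end

theory Submission
  imports Defs
begin

text \<open>
  Putting \<open>b = c = \<one>\<close> in the truss law gives \<open>\<Phi> a = a \<circ> \<one>\<close>, so \<open>\<Phi>\<close> is right translation by the unit of
  the group. Associativity of \<open>\<circ>\<close> then yields \<open>\<Phi> (a \<circ> b) = a \<circ> \<Phi> b\<close>, and the truss law itself says
  that each \<open>b \<mapsto> a \<rhd> b\<close> is an endomorphism of the group. Together these imply
  \<open>(a \<circ> b) \<rhd> c = a \<rhd> (b \<rhd> c)\<close>. Hence every axiom of a twisted post-group holds in any skew truss,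
  except bijectivity of the maps \<open>b \<mapsto> a \<rhd> b\<close>. Such a map is \<open>b \<mapsto> a \<circ> b\<close> followed by the left
  translation by \<open>(\<Phi> a)\<inverse>\<close>, which is a bijection; so its bijectivity is exactly the unique solvability
  of \<open>a \<circ> t = b\<close>.
\<close>

lemma right_divisible_on_iff_bij_betw:
  assumes "\<And>a b. \<lbrakk>a \<in> S; b \<in> S\<rbrakk> \<Longrightarrow> f a b \<in> S"
  shows "right_divisible_on S f \<longleftrightarrow> (\<forall>a\<in>S. bij_betw (f a) S S)"
proof -
  have "(\<forall>b\<in>S. \<exists>!t. t \<in> S \<and> f a t = b) \<longleftrightarrow> bij_betw (f a) S S" if "a \<in> S" for a
  proof
    assume ex1: "\<forall>b\<in>S. \<exists>!t. t \<in> S \<and> f a t = b"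
    have "inj_on (f a) S"
      using ex1 assms[OF that] by (intro inj_onI) blast
    moreover have "f a ` S = S"
      using ex1 assms[OF that] by blast
    ultimately show "bij_betw (f a) S S"
      by (simp add: bij_betw_def)
  next
    assume bij: "bij_betw (f a) S S"
    show "\<forall>b\<in>S. \<exists>!t. t \<in> S \<and> f a t = b"
    proof
      fix b assume "b \<in> S"
      then obtain t where "t \<in> S" "f a t = b"
        using bij by (metis bij_betw_imp_surj_on imageE)
      then show "\<exists>!t. t \<in> S \<and> f a t = b"
        using bij by (auto simp: bij_betw_def dest: inj_onD)
    qed
  qed
  then show ?thesis
    by (simp add: right_divisible_on_def)
qed

lemma (in group) bij_betw_left_translation:
  assumes "g \<in> carrier G"
  shows "bij_betw (\<lambda>x. g \<otimes> x) (carrier G) (carrier G)"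
  using assms
  by (intro bij_betw_byWitness[where f' = "\<lambda>x. inv g \<otimes> x"])
    (auto simp: m_assoc[symmetric])

lemma (in group) bij_betw_left_translation_comp_iff:
  assumes "g \<in> carrier G" and "f \<in> carrier G \<rightarrow> carrier G"
  shows "bij_betw (\<lambda>x. g \<otimes> f x) (carrier G) (carrier G)
    \<longleftrightarrow> bij_betw f (carrier G) (carrier G)"
  using bij_betw_comp_iff2[OF bij_betw_left_translation[OF assms(1)], of f "carrier G"] assms(2)
  by (auto simp: comp_def)

lemma (in group) left_translation_cancels_in_quotient:
  assumes [simp]: "p \<in> carrier G" "x \<in> carrier G" "y \<in> carrier G"
  shows "inv (p \<otimes> x) \<otimes> (p \<otimes> y) = inv x \<otimes> y"
proof -
  have "inv p \<otimes> (p \<otimes> y) = y"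
    by (simp add: m_assoc[symmetric])
  then show ?thesis
    by (simp add: inv_mult_group m_assoc)
qed

context skew_truss
begin

definition tri :: "'a \<Rightarrow> 'a \<Rightarrow> 'a" (infixr \<open>\<rhd>\<close> 70) where
  "a \<rhd> b = inv (\<Phi> a) \<otimes> (a \<circ>\<^sub>t b)"

lemma circ_closed: "\<lbrakk>a \<in> carrier G; b \<in> carrier G\<rbrakk> \<Longrightarrow> a \<circ>\<^sub>t b \<in> carrier G"
  using semigroup_circ by (simp add: semigroup_on_def)

lemma circ_assoc:
  "\<lbrakk>a \<in> carrier G; b \<in> carrier G; c \<in> carrier G\<rbrakk> \<Longrightarrow> (a \<circ>\<^sub>t b) \<circ>\<^sub>t c = a \<circ>\<^sub>t (b \<circ>\<^sub>t c)"
  using semigroup_circ by (simp add: semigroup_on_def)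

lemma Phi_in_carrier: "a \<in> carrier G \<Longrightarrow> \<Phi> a \<in> carrier G"
  using Phi_closed by auto

lemma tri_in_carrier: "\<lbrakk>a \<in> carrier G; b \<in> carrier G\<rbrakk> \<Longrightarrow> a \<rhd> b \<in> carrier G"
  by (simp add: tri_def circ_closed Phi_in_carrier)

text \<open>The truss law at \<open>\<one> \<otimes> \<one> = \<one>\<close> reads \<open>x = x \<otimes> (\<Phi> a)\<inverse> \<otimes> x\<close> for \<open>x = a \<circ> \<one>\<close>; cancel \<open>x\<close>.\<close>
lemma Phi_eq_circ_one:
  assumes a: "a \<in> carrier G"
  shows "\<Phi> a = a \<circ>\<^sub>t \<one>"
proof -
  define x where "x = a \<circ>\<^sub>t \<one>"
  have x: "x \<in> carrier G" and p: "\<Phi> a \<in> carrier G"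
    by (simp_all add: x_def a circ_closed Phi_in_carrier)
  have "x \<otimes> inv (\<Phi> a) \<otimes> x = x"
    using circ_mult[OF a, of \<one> \<one>] by (simp add: x_def)
  then have "x \<otimes> inv (\<Phi> a) = \<one>"
    using x p r_cancel_one by simp
  then show ?thesis
    using x p by (metis inv_equality inv_inv inv_closed x_def)
qed

lemma Phi_circ:
  "\<lbrakk>a \<in> carrier G; b \<in> carrier G\<rbrakk> \<Longrightarrow> \<Phi> (a \<circ>\<^sub>t b) = a \<circ>\<^sub>t \<Phi> b"
  by (simp add: Phi_eq_circ_one circ_closed circ_assoc)

lemma circ_eq_Phi_mult_tri:
  "\<lbrakk>a \<in> carrier G; b \<in> carrier G\<rbrakk> \<Longrightarrow> \<Phi> a \<otimes> (a \<rhd> b) = a \<circ>\<^sub>t b"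
  by (simp add: tri_def m_assoc[symmetric] Phi_in_carrier circ_closed)

lemma twisted_circ_tri:
  "\<lbrakk>a \<in> carrier G; b \<in> carrier G\<rbrakk> \<Longrightarrow> twisted_circ G (\<rhd>) \<Phi> a b = a \<circ>\<^sub>t b"
  by (simp add: twisted_circ_def circ_eq_Phi_mult_tri)

lemma tri_hom: "a \<in> carrier G \<Longrightarrow> (\<lambda>b. a \<rhd> b) \<in> hom G G"
  by (rule homI) (simp_all add: tri_in_carrier tri_def circ_mult m_assoc Phi_in_carrier circ_closed)

text \<open>
  As \<open>b \<rhd> c = (\<Phi> b)\<inverse> \<otimes> (b \<circ> c)\<close> and \<open>a \<rhd> _\<close> is an endomorphism,
  \<open>a \<rhd> (b \<rhd> c) = (a \<rhd> \<Phi> b)\<inverse> \<otimes> (a \<rhd> (b \<circ> c))\<close>. Both terms of this left quotient are images of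
  left translation by \<open>(\<Phi> a)\<inverse>\<close>, which cancels and leaves \<open>(a \<circ> \<Phi> b)\<inverse> \<otimes> (a \<circ> (b \<circ> c))\<close>; since
  \<open>a \<circ> \<Phi> b = \<Phi> (a \<circ> b)\<close>, this is \<open>(a \<circ> b) \<rhd> c\<close>.
\<close>
lemma circ_tri:
  assumes a: "a \<in> carrier G" and b: "b \<in> carrier G" and c: "c \<in> carrier G"
  shows "(a \<circ>\<^sub>t b) \<rhd> c = a \<rhd> (b \<rhd> c)"
proof -
  interpret tri_a: group_hom G G "\<lambda>b. a \<rhd> b"
    using tri_hom[OF a] by unfold_locales
  note closed = a b c circ_closed Phi_in_carrier tri_in_carrier
  have "a \<rhd> (b \<rhd> c) = inv (a \<rhd> \<Phi> b) \<otimes> (a \<rhd> (b \<circ>\<^sub>t c))"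
    by (simp add: tri_def[of b c] closed)
  also have "\<dots> = inv (\<Phi> a \<otimes> (a \<rhd> \<Phi> b)) \<otimes> (\<Phi> a \<otimes> (a \<rhd> (b \<circ>\<^sub>t c)))"
    by (simp add: left_translation_cancels_in_quotient closed)
  also have "\<dots> = inv (a \<circ>\<^sub>t \<Phi> b) \<otimes> (a \<circ>\<^sub>t (b \<circ>\<^sub>t c))"
    by (simp add: circ_eq_Phi_mult_tri closed)
  also have "\<dots> = (a \<circ>\<^sub>t b) \<rhd> c"
    by (simp add: tri_def[of "a \<circ>\<^sub>t b"] Phi_circ circ_assoc closed)
  finally show ?thesis by simp
qed

lemma twisted_post_group_iff_bij_betw_tri:
  "twisted_post_group G (\<rhd>) \<Phi>
    \<longleftrightarrow> (\<forall>a\<in>carrier G. bij_betw (\<lambda>b. a \<rhd> b) (carrier G) (carrier G))"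
proof
  assume "twisted_post_group G (\<rhd>) \<Phi>"
  then interpret post: twisted_post_group G "(\<rhd>)" \<Phi> .
  show "\<forall>a\<in>carrier G. bij_betw (\<lambda>b. a \<rhd> b) (carrier G) (carrier G)"
    using post.tri_automorphism by (simp add: iso_def)
next
  assume "\<forall>a\<in>carrier G. bij_betw (\<lambda>b. a \<rhd> b) (carrier G) (carrier G)"
  then show "twisted_post_group G (\<rhd>) \<Phi>"
    by unfold_locales
      (simp_all add: tri_in_carrier Phi_closed Phi_in_carrier iso_def tri_hom
        twisted_circ_tri circ_tri Phi_circ)
qed

lemma bij_betw_tri_iff_bij_betw_circ:
  "a \<in> carrier G \<Longrightarrow> bij_betw (\<lambda>b. a \<rhd> b) (carrier G) (carrier G)
    \<longleftrightarrow> bij_betw (\<lambda>b. a \<circ>\<^sub>t b) (carrier G) (carrier G)"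
  unfolding tri_def
  by (rule bij_betw_left_translation_comp_iff) (auto simp: Phi_in_carrier circ_closed)

end

theorem proposition4p6:
  fixes G :: "('a, 'm) monoid_scheme"
    and circ :: "'a \<Rightarrow> 'a \<Rightarrow> 'a"
    and \<Phi> :: "'a \<Rightarrow> 'a"
  assumes "skew_truss G circ \<Phi>"
  shows "twisted_post_group G (\<lambda>a b. inv\<^bsub>G\<^esub> (\<Phi> a) \<otimes>\<^bsub>G\<^esub> circ a b) \<Phi>
     \<longleftrightarrow> right_divisible_on (carrier G) circ"
proof -
  interpret skew_truss G circ \<Phi>
    by (fact assms)
  have "(\<lambda>a b. inv\<^bsub>G\<^esub> (\<Phi> a) \<otimes>\<^bsub>G\<^esub> circ a b) = tri"
    by (simp add: fun_eq_iff tri_def)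
  then show ?thesis
    by (simp add: twisted_post_group_iff_bij_betw_tri bij_betw_tri_iff_bij_betw_circ
        right_divisible_on_iff_bij_betw circ_closed)
qed

end
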